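(* Let $G$ be a finite 3-group that is semi-3-abelian but not semi-9-abelian, and such that every proper subgroup of $G$ is semi-9-abelian. Then $G_{7}=1$, i.e. $G$ has nilpotency class at most $6$.
   Context: Let $p$ be a prime and $G$ a finite $p$-group. For a positive integer $i$, $G$ is called semi-$p^{i}$-abelian if for all $a,b\in G$: $(ab)^{p^{i}}=1$ if and only if $a^{p^{i}}b^{p^{i}}=1$. The lower central series is $G_1=G$, $G_{k+1}=[G_k,G]$, where $[x,y]=x^{-1}y^{-1}xy$. *)

theory Defs
  imports "HOL-Algebra.Algebra"
begin

definition commutator :: "('a, 'b) monoid_scheme \<Rightarrow> 'a \<Rightarrow> 'a \<Rightarrow> 'a" where
  "commutator G x y = inv\<^bsub>G\<^esub> x \<otimes>\<^bsub>G\<^esub> inv\<^bsub>G\<^esub> y \<otimes>\<^bsub>G\<^esub> x \<otimes>\<^bsub>G\<^esub> y"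

definition commutator_subgroup :: "('a, 'b) monoid_scheme \<Rightarrow> 'a set \<Rightarrow> 'a set \<Rightarrow> 'a set" where
  "commutator_subgroup G H K = generate G {commutator G h k | h k. h \<in> H \<and> k \<in> K}"

text \<open>lcs G n is the term G_(n+1) of the lower central series (G_1 = G).\<close>
primrec lcs :: "('a, 'b) monoid_scheme \<Rightarrow> nat \<Rightarrow> 'a set" where
  "lcs G 0 = carrier G"
| "lcs G (Suc n) = commutator_subgroup G (lcs G n) (carrier G)"

text \<open>Paper indexing: lower_central_term G k = G_k for k \<ge> 1.\<close>
definition lower_central_term :: "('a, 'b) monoid_scheme \<Rightarrow> nat \<Rightarrow> 'a set" where
  "lower_central_term G k = lcs G (k - 1)"

definition p_group :: "('a, 'b) monoid_scheme \<Rightarrow> nat \<Rightarrow> bool" where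
  "p_group G p \<longleftrightarrow> group G \<and> finite (carrier G) \<and> (\<exists>n. card (carrier G) = p ^ n)"

definition semi_abelian :: "('a, 'b) monoid_scheme \<Rightarrow> nat \<Rightarrow> nat \<Rightarrow> bool" where
  "semi_abelian G p i \<longleftrightarrow> (\<forall>a \<in> carrier G. \<forall>b \<in> carrier G.
     ((a \<otimes>\<^bsub>G\<^esub> b) [^]\<^bsub>G\<^esub> (p ^ i) = \<one>\<^bsub>G\<^esub>
       \<longleftrightarrow> (a [^]\<^bsub>G\<^esub> (p ^ i)) \<otimes>\<^bsub>G\<^esub> (b [^]\<^bsub>G\<^esub> (p ^ i)) = \<one>\<^bsub>G\<^esub>))"

end

theory Submission
  imports Defs
begin

text \<open>Let \<open>\<Omega>\<close> be the set of elements with \<open>x\<^sup>3 = 1\<close>, a normal subgroup since \<open>G\<close> is semi-3-abelian.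
  A pair \<open>a, b\<close> violating the semi-9-abelian condition generates \<open>G\<close>, and each element of \<open>G\<close> lies
  in a proper normal, hence semi-9-abelian, subgroup \<open>M\<close>; comparing \<open>x\<close> with its conjugate
  \<open>y\<^bsup>-1\<^esup>xy\<close> inside \<open>M\<close> shows that \<open>[x,y]\<^sup>9 = 1\<close> iff \<open>x\<^sup>9\<close> commutes with \<open>y\<close>. Either
  \<open>(ab)\<^sup>9 = 1\<close>, or \<open>a\<^sup>9 = b\<^bsup>-9\<^esup>\<close> and then \<open>[a,b]\<^sup>9 = 1\<close>; in both cases \<open>[a,b]\<close> lies in
  a normal subgroup of exponent dividing 9, which therefore contains all commutators. So ninth powers
  are central, which means that cubes are central modulo \<open>\<Omega>\<close>. A 2-generated group of exponent 3 has
  class at most 2, hence \<open>G/\<Omega>\<close> has class at most 3 and \<open>G\<^sub>4 \<subseteq> \<Omega>\<close>. For \<open>x \<in> \<Omega>\<close> the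
  identity \<open>(gx)\<^sup>3 = g\<^sup>3\<close> makes the normal closure of \<open>x\<close> abelian and gives \<open>[x,g,g] = 1\<close>; in
  characteristic 3 this forces \<open>[x,g,h,k] = 1\<close>.\<close>

section \<open>Commutator words and the consequences of (gx)^3 = g^3\<close>

context group
begin

lemma inv_cancel_left:
  assumes "x \<in> carrier G" "y \<in> carrier G"
  shows "x \<otimes> (inv x \<otimes> y) = y" "inv x \<otimes> (x \<otimes> y) = y"
  using assms by (simp_all add: m_assoc[symmetric])

lemmas word_simps = m_assoc inv_mult_group inv_cancel_left

lemma pow_3:
  assumes "x \<in> carrier G" shows "x [^] (3::nat) = x \<otimes> (x \<otimes> x)"
  using assms by (simp add: numeral_3_eq_3 m_assoc)

lemma commutator_closed [simp]:
  "x \<in> carrier G \<Longrightarrow> y \<in> carrier G \<Longrightarrow> commutator G x y \<in> carrier G"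
  by (simp add: commutator_def)

lemma commutator_mult_right:
  assumes "x \<in> carrier G" "g \<in> carrier G" "h \<in> carrier G"
  shows "commutator G x (g \<otimes> h)
    = commutator G x h \<otimes> (commutator G x g \<otimes> commutator G (commutator G x g) h)"
  using assms by (simp add: commutator_def word_simps)

lemma inv_commutator:
  assumes "x \<in> carrier G" "y \<in> carrier G"
  shows "inv (commutator G x y) = commutator G y x"
  using assms by (simp add: commutator_def word_simps)

lemma commutator_eq_one_iff:
  assumes "x \<in> carrier G" "y \<in> carrier G"
  shows "commutator G x y = \<one> \<longleftrightarrow> x \<otimes> y = y \<otimes> x"
proof -
  have "commutator G x y = inv (y \<otimes> x) \<otimes> (x \<otimes> y)"
    using assms by (simp add: commutator_def word_simps)
  then show ?thesis
    using assms by (metis inv_closed inv_equality inv_inv l_inv m_closed)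
qed

text \<open>Collecting the factors g of (gx)^3 on the left leaves g^3 times the product of the
  conjugates of x by g^2, by g and by 1, in this order. Equality with g^3 makes that product
  trivial.\<close>

lemma cube_mult_eq:
  assumes "g \<in> carrier G" "x \<in> carrier G" "(g \<otimes> x) [^] (3::nat) = g [^] (3::nat)"
  shows "(inv g \<otimes> (inv g \<otimes> x \<otimes> g) \<otimes> g) \<otimes> (inv g \<otimes> x \<otimes> g) \<otimes> x = \<one>"
proof -
  have "(g \<otimes> x) [^] (3::nat)
      = g [^] (3::nat) \<otimes> ((inv g \<otimes> (inv g \<otimes> x \<otimes> g) \<otimes> g) \<otimes> (inv g \<otimes> x \<otimes> g) \<otimes> x)"
    using assms(1,2) by (simp add: pow_3 word_simps)
  then show ?thesis
    using assms by simp
qed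

text \<open>Write y, z for the conjugates of x by g and g^2. The cube identity for x gives zyx = 1;
  the one for the inverse of x, after inversion, gives xyz = 1. So both xy and yx are the inverse of
  z.\<close>

lemma commute_conjugate:
  assumes g: "g \<in> carrier G" and x: "x \<in> carrier G"
    and "(g \<otimes> x) [^] (3::nat) = g [^] (3::nat)" "(g \<otimes> inv x) [^] (3::nat) = g [^] (3::nat)"
  shows "x \<otimes> (inv g \<otimes> x \<otimes> g) = (inv g \<otimes> x \<otimes> g) \<otimes> x"
proof -
  define y where "y = inv g \<otimes> x \<otimes> g"
  define z where "z = inv g \<otimes> y \<otimes> g"
  have yz: "y \<in> carrier G" "z \<in> carrier G" using g x by (auto simp: y_def z_def)
  have "inv y = inv g \<otimes> inv x \<otimes> g" using g x by (simp add: y_def word_simps)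
  moreover have "inv z = inv g \<otimes> inv y \<otimes> g" using g yz by (simp add: z_def word_simps)
  ultimately have "inv z \<otimes> inv y \<otimes> inv x = \<one>"
    using cube_mult_eq[of g "inv x"] assms by simp
  then have "inv (x \<otimes> y \<otimes> z) = \<one>" using x yz by (simp add: word_simps)
  then have "x \<otimes> y \<otimes> z = \<one>" using x yz by (metis inv_eq_1_iff m_closed)
  moreover have "z \<otimes> (y \<otimes> x) = \<one>"
    using cube_mult_eq[of g x] assms yz by (simp add: y_def z_def m_assoc)
  ultimately show ?thesis
    unfolding y_def[symmetric] using x yz
    by (metis inv_equality inv_inv m_closed)
qed

text \<open>In exponent notation, with g acting by conjugation, [x,g,g] is x^((g-1)^2). Since x
  commutes with its conjugate by g and x^3 = 1, (g-1)^2 may be replaced by g^2 + g + 1, which kills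
  x by \<open>cube_mult_eq\<close>.\<close>

lemma commutator_commutator_one:
  assumes g: "g \<in> carrier G" and x: "x \<in> carrier G" and x3: "x [^] (3::nat) = \<one>"
    and cubes: "(g \<otimes> x) [^] (3::nat) = g [^] (3::nat)" "(g \<otimes> inv x) [^] (3::nat) = g [^] (3::nat)"
  shows "commutator G (commutator G x g) g = \<one>"
proof -
  define y where "y = inv g \<otimes> x \<otimes> g"
  define z where "z = inv g \<otimes> y \<otimes> g"
  have yz: "y \<in> carrier G" "z \<in> carrier G" using g x by (auto simp: y_def z_def)
  have comm: "x \<otimes> y = y \<otimes> x" using commute_conjugate[OF g x cubes] by (simp add: y_def)
  have "y [^] (3::nat) = inv g \<otimes> x [^] (3::nat) \<otimes> g"
    using g x by (simp add: y_def pow_3 word_simps)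
  then have y3: "y \<otimes> (y \<otimes> y) = \<one>" using g yz x3 by (simp add: pow_3)
  have "z \<otimes> (y \<otimes> x) = \<one>"
    using cube_mult_eq[OF g x cubes(1)] x yz by (simp add: y_def z_def m_assoc)
  then have z: "z = inv x \<otimes> inv y"
    using x yz by (metis inv_equality inv_mult_group m_closed)
  have "commutator G x g = inv x \<otimes> y"
    using g x by (simp add: commutator_def y_def word_simps)
  then have "commutator G (commutator G x g) g = inv y \<otimes> x \<otimes> (inv y \<otimes> z)"
    using g x yz by (simp add: commutator_def z_def y_def word_simps)
  also have "\<dots> = inv y \<otimes> (x \<otimes> (inv y \<otimes> inv x)) \<otimes> inv y"
    unfolding z using x yz by (simp add: m_assoc)
  also have "inv y \<otimes> inv x = inv x \<otimes> inv y"
    using comm x yz by (metis inv_mult_group)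
  also have "inv y \<otimes> (x \<otimes> (inv x \<otimes> inv y)) \<otimes> inv y = inv (y \<otimes> (y \<otimes> y))"
    using x yz by (simp add: word_simps)
  finally show ?thesis using y3 by simp
qed

text \<open>On an abelian normal subgroup \<open>V\<close> of exponent 3 write \<open>X\<close>, \<open>Y\<close>, \<open>Z\<close> for the
  endomorphisms \<open>v \<mapsto> [v,g]\<close>, \<open>v \<mapsto> [v,h]\<close>, \<open>v \<mapsto> [v,k]\<close>, composed from left to right, so that
  \<open>[v,gh]\<close> is the image of \<open>v\<close> under \<open>Y + X + XY\<close>. If all such endomorphisms have square zero, then
  expanding \<open>(Y + X + XY)\<^sup>2 = 0\<close> gives \<open>XY = -YX\<close>; since \<open>Y + X + XY\<close> also anticommutes with \<open>Z\<close>, we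
  get \<open>ZXY = -XYZ\<close>, while \<open>ZXY = -XZY = XYZ\<close>. Hence \<open>2XYZ = 0\<close>.\<close>

lemma triple_commutator_one:
  assumes V: "V \<lhd> G"
    and comm: "\<And>v w. v \<in> V \<Longrightarrow> w \<in> V \<Longrightarrow> v \<otimes> w = w \<otimes> v"
    and exp3: "\<And>v. v \<in> V \<Longrightarrow> v [^] (3::nat) = \<one>"
    and engel: "\<And>v g. v \<in> V \<Longrightarrow> g \<in> carrier G \<Longrightarrow> commutator G (commutator G v g) g = \<one>"
    and v: "v \<in> V" and g: "g \<in> carrier G" and h: "h \<in> carrier G" and k: "k \<in> carrier G"
  shows "commutator G (commutator G (commutator G v g) h) k = \<one>"
proof -
  interpret V: normal V G by (fact V)
  let ?c = "commutator G"
  have closed [simp]: "?c v g \<in> V" if "v \<in> V" "g \<in> carrier G" for v g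
  proof -
    have "?c v g = inv v \<otimes> (inv g \<otimes> v \<otimes> g)" using that V.subset by (auto simp: commutator_def m_assoc)
    then show ?thesis using that by (simp add: V.inv_op_closed1)
  qed
  have lcomm: "v \<otimes> (w \<otimes> u) = w \<otimes> (v \<otimes> u)" if "u \<in> V" "v \<in> V" "w \<in> V" for u v w
    using that comm[of v w] by (metis V.mem_carrier m_assoc)
  note ac = m_assoc comm lcomm
  have one [simp]: "?c \<one> g = \<one>" if "g \<in> carrier G" for g using that by (simp add: commutator_def)
  have mult: "?c (v \<otimes> w) g = ?c v g \<otimes> ?c w g" if "v \<in> V" "w \<in> V" "g \<in> carrier G" for v w g
  proof -
    have "?c (v \<otimes> w) g = inv w \<otimes> (inv v \<otimes> (inv g \<otimes> v \<otimes> g)) \<otimes> (inv g \<otimes> w \<otimes> g)"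
      using that by (simp add: commutator_def word_simps)
    also have "\<dots> = (inv v \<otimes> (inv g \<otimes> v \<otimes> g)) \<otimes> inv w \<otimes> (inv g \<otimes> w \<otimes> g)"
      using that comm[of "inv w" "inv v \<otimes> (inv g \<otimes> v \<otimes> g)"] by (simp add: V.inv_op_closed1)
    also have "\<dots> = ?c v g \<otimes> ?c w g" using that by (simp add: commutator_def word_simps)
    finally show ?thesis .
  qed
  have inv_left: "?c (inv v) g = inv (?c v g)" if "v \<in> V" "g \<in> carrier G" for v g
    using mult[of "inv v" v g] that by (simp add: inv_equality)
  have anti: "?c (?c v g) h = inv (?c (?c v h) g)"
    if gh [simp]: "g \<in> carrier G" "h \<in> carrier G" and "v \<in> V" for v g h
  proof -
    have eq: "?c (?c v g) h \<otimes> (?c (?c v h) g \<otimes> (?c (?c (?c v g) h) g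
        \<otimes> (?c (?c (?c v h) g) h \<otimes> ?c (?c (?c (?c v g) h) g) h))) = \<one>" if [simp]: "v \<in> V" for v
    proof -
      have "\<one> = ?c (?c v (g \<otimes> h)) (g \<otimes> h)" by (simp add: engel)
      also have "\<dots> = ?c (?c v g) h \<otimes> (?c (?c v h) g \<otimes> (?c (?c (?c v g) h) g
        \<otimes> (?c (?c (?c v h) g) h \<otimes> ?c (?c (?c (?c v g) h) g) h)))"
        by (simp add: commutator_mult_right mult engel ac)
      finally show ?thesis by simp
    qed
    have v [simp]: "v \<in> V" by fact
    \<comment> \<open>The identity \<open>eq\<close> says XY + YX + XYX + YXY + XYXY = 0. Evaluated
      at [u,g] it leaves XYX + XYXY = 0, since X^2 = 0. Subtracting this gives XY + YX + YXY = 0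
      (fact \<open>2\<close>), and evaluating that at [u,h] gives YXY = 0 (fact
      \<open>3\<close>).\<close>
    have 1: "?c (?c (?c u g) h) g \<otimes> ?c (?c (?c (?c u g) h) g) h = \<one>" if [simp]: "u \<in> V" for u
      using eq[of "?c u g"] by (simp add: engel)
    have 2: "?c (?c u g) h \<otimes> (?c (?c u h) g \<otimes> ?c (?c (?c u h) g) h) = \<one>" if [simp]: "u \<in> V" for u
    proof -
      have "?c (?c u g) h \<otimes> (?c (?c u h) g \<otimes> (?c (?c (?c u h) g) h
          \<otimes> (?c (?c (?c u g) h) g \<otimes> ?c (?c (?c (?c u g) h) g) h))) = \<one>"
        using eq[of u] by (simp add: ac)
      then show ?thesis by (simp add: 1)
    qed
    have 3: "?c (?c (?c u h) g) h = \<one>" if [simp]: "u \<in> V" for u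
      using 2[of "?c u h"] by (simp add: engel)
    show ?thesis using 2[of v] by (simp add: 3 inv_equality)
  qed
  note [simp] = v g h k
  let ?t = "?c (?c (?c v g) h) k"
  have "?c (?c v k) (g \<otimes> h) = inv (?c (?c v (g \<otimes> h)) k)" by (rule anti) simp_all
  then have "?c (?c v k) h \<otimes> (?c (?c v k) g \<otimes> ?c (?c (?c v k) g) h)
      = inv (?c (?c v h) k) \<otimes> (inv (?c (?c v g) k) \<otimes> inv ?t)"
    by (simp add: commutator_mult_right mult ac inv_mult_group)
  then have "?c (?c (?c v k) g) h = inv ?t"
    by (simp add: anti[of k h v] anti[of k g v])
  moreover have "?c (?c (?c v k) g) h = ?t"
  proof -
    have "?c (?c (?c v k) g) h = ?c (inv (?c (?c v g) k)) h" by (subst anti) simp_all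
    also have "\<dots> = inv (?c (?c (?c v g) k) h)" by (rule inv_left) simp_all
    also have "\<dots> = ?t" by (rule anti[symmetric]) simp_all
    finally show ?thesis .
  qed
  ultimately have "?t = inv ?t" by simp
  then have "?t \<otimes> ?t = \<one>" by (metis V.mem_carrier closed g h k r_inv v)
  moreover have "?t \<otimes> (?t \<otimes> ?t) = \<one>"
    using exp3[of ?t] by (simp add: pow_3)
  ultimately show ?thesis by simp
qed

section \<open>Fixed points of p-group actions and normality of maximal subgroups\<close>

lemma rcosets_action:
  assumes "subgroup M G"
  shows "group_action G (rcosets M) (\<lambda>g. \<lambda>R \<in> rcosets M. R #> inv g)"
proof -
  \<comment> \<open>Right multiplication is a right action, so the inverse is needed to obtain a
    homomorphism. The restricted lambda supplies the extensional functions that make up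
    \<open>BijGroup\<close>.\<close>
  let ?E = "rcosets M" and ?\<phi> = "\<lambda>g. \<lambda>R \<in> rcosets M. R #> inv g"
  have sub: "R \<subseteq> carrier G" if "R \<in> ?E" for R
    using that assms by (simp add: subgroup.rcosets_carrier)
  have closed: "R #> g \<in> ?E" if "R \<in> ?E" "g \<in> carrier G" for R g
    using that subgroup.subset[OF assms] by (auto simp: RCOSETS_def coset_mult_assoc)
  have bij: "bij_betw (\<lambda>R. R #> inv g) ?E ?E" if "g \<in> carrier G" for g
    by (rule bij_betw_byWitness[where f' = "\<lambda>R. R #> g"])
      (use that sub in \<open>auto simp: closed coset_mult_assoc\<close>)
  have "?\<phi> \<in> hom G (BijGroup ?E)"
  proof (rule homI)
    fix g assume "g \<in> carrier G"
    then show "?\<phi> g \<in> carrier (BijGroup ?E)"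
      using bij[of g] by (auto simp: BijGroup_def Bij_def cong: bij_betw_cong)
  next
    fix g h assume gh: "g \<in> carrier G" "h \<in> carrier G"
    then have "?\<phi> g \<in> Bij ?E" "?\<phi> h \<in> Bij ?E"
      using bij by (auto simp: Bij_def cong: bij_betw_cong)
    then show "?\<phi> (g \<otimes> h) = ?\<phi> g \<otimes>\<^bsub>BijGroup ?E\<^esub> ?\<phi> h"
      using gh sub by (auto simp: BijGroup_def compose_def fun_eq_iff closed inv_mult_group coset_mult_assoc)
  qed
  then show ?thesis
    unfolding group_action_def group_hom_def group_hom_axioms_def
    using group_BijGroup by (auto simp: is_group)
qed

end

text \<open>Orbit sizes divide \<open>p ^ n\<close>, so every orbit with more than one point has
  size divisible by \<open>p\<close>. Were \<open>x\<close> the only fixed point,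
  \<open>card E\<close> would be 1 modulo \<open>p\<close>.\<close>

lemma (in group_action) fixed_points_ne_1:
  assumes p: "Factorial_Ring.prime p" and ord: "order G = p ^ n" and E: "finite E" "p dvd card E"
    and x: "x \<in> E" "\<And>g. g \<in> carrier G \<Longrightarrow> \<phi> g x = x"
  obtains y where "y \<in> E" "y \<noteq> x" "\<And>g. g \<in> carrier G \<Longrightarrow> \<phi> g y = y"
proof (rule ccontr)
  assume "\<not> thesis"
  with that have no: "\<exists>g \<in> carrier G. \<phi> g y \<noteq> y" if "y \<in> E" "y \<noteq> x" for y using that by blast
  have orb_x: "orbit G \<phi> x = {x}"
    using x orbit_refl[OF x(1)] by (auto simp: orbit_def)
  have sub: "orb \<subseteq> E" if "orb \<in> orbits G E \<phi>" for orb
    using that element_image by (auto simp: orbits_def orbit_def)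
  have dvd: "p dvd card orb" if orb: "orb \<in> orbits G E \<phi> - {{x}}" for orb
  proof -
    obtain y where y: "y \<in> E" "orb = orbit G \<phi> y" using orb by (auto simp: orbits_def)
    have "y \<noteq> x" using y orb orb_x by auto
    then obtain g where "g \<in> carrier G" "\<phi> g y \<noteq> y" using no y by blast
    then have "{y, \<phi> g y} \<subseteq> orb" using y orbit_refl by (auto simp: orbit_def)
    then have "card orb \<noteq> 1" using \<open>\<phi> g y \<noteq> y\<close> by (metis card_1_singletonE insert_subset singletonD)
    moreover have "card orb dvd p ^ n"
      using orbit_stabilizer_theorem[OF y(1)] y(2) ord by (metis dvd_triv_left)
    ultimately show ?thesis
      using p by (metis divides_primepow_nat dvd_refl dvd_power_same power_0 dvd_power neq0_conv)
  qed
  have fin: "finite (orbits G E \<phi>)"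
    using E(1) sub by (meson Pow_iff finite_Pow_iff finite_subset subsetI)
  have x_orb: "{x} \<in> orbits G E \<phi>" using x(1) orb_x by (auto simp: orbits_def)
  have "card E = (\<Sum>orb\<in>orbits G E \<phi>. card orb)"
    using disjoint_sum[OF E(1), of "\<lambda>_. 1 :: nat"] by simp
  also have "\<dots> = 1 + (\<Sum>orb\<in>orbits G E \<phi> - {{x}}. card orb)"
    using sum.remove[OF fin x_orb, of card] by simp
  finally have "p dvd 1 + (\<Sum>orb\<in>orbits G E \<phi> - {{x}}. card orb)" using E(2) by simp
  moreover have "p dvd (\<Sum>orb\<in>orbits G E \<phi> - {{x}}. card orb)" using dvd by (rule dvd_sum)
  ultimately have "p dvd 1" by (simp only: dvd_add_left_iff)
  then show False using p by simp
qed

text \<open>Let \<open>M\<close> act on its own cosets by right multiplication. Their number is a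
  positive power of \<open>p\<close> and the coset \<open>M\<close> is fixed, so a second coset Mg
  is fixed too. Then g normalizes \<open>M\<close> without lying in it, and maximality makes the
  normalizer the whole group.\<close>

lemma p_group_maximal_normal:
  fixes G (structure)
  assumes pG: "p_group G p" and p: "Factorial_Ring.prime p" and M: "subgroup M G" "M \<noteq> carrier G"
    and max: "\<And>K. subgroup K G \<Longrightarrow> M \<subseteq> K \<Longrightarrow> K = M \<or> K = carrier G"
  shows "M \<lhd> G"
proof -
  interpret group G using pG by (simp add: p_group_def)
  interpret M: subgroup M G by (fact M(1))
  have fin: "finite (carrier G)" using pG by (simp add: p_group_def)
  obtain n where n: "order G = p ^ n" using pG by (auto simp: p_group_def order_def)
  let ?\<phi> = "\<lambda>g. \<lambda>R \<in> rcosets M. R #> inv g"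
  interpret A: group_action "G\<lparr>carrier := M\<rparr>" "rcosets M" ?\<phi>
    using group_action.induced_action[OF rcosets_action[OF M(1)] M(1)] .
  have lag: "card (rcosets M) * card M = p ^ n" using lagrange[OF M(1)] n by simp
  then have "card M dvd p ^ n" "card (rcosets M) dvd p ^ n" by (metis dvd_triv_right, metis dvd_triv_left)
  then obtain m r where m: "card M = p ^ m" and r: "card (rcosets M) = p ^ r"
    using p by (meson divides_primepow_nat)
  have finE: "finite (rcosets M)" using fin by (simp add: rcosets_part_G RCOSETS_def)
  have "r \<noteq> 0"
  proof
    assume "r = 0"
    then have "card M = card (carrier G)" using r lagrange[OF M(1)] by (simp add: order_def)
    then show False using M(2) fin M.subset by (metis card_subset_eq)
  qed
  then have dvd: "p dvd card (rcosets M)" using r by simp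
  have M_E: "M \<in> rcosets M" by (rule subgroup.subgroup_in_rcosets[OF M(1) is_group])
  have fix_M: "?\<phi> g M = M" if "g \<in> carrier (G\<lparr>carrier := M\<rparr>)" for g
    using that M_E by (simp add: M.rcos_const)
  obtain R where R: "R \<in> rcosets M" "R \<noteq> M"
      and fixed: "\<And>g. g \<in> M \<Longrightarrow> ?\<phi> g R = R"
    using A.fixed_points_ne_1[OF p _ finE dvd M_E fix_M, of m] m by (auto simp: order_def)
  obtain g where g: "g \<in> carrier G" "R = M #> g" using R(1) by (auto simp: RCOSETS_def)
  \<comment> \<open>The normalizer of \<open>M\<close>, with both directions of conjugation required
    so that closure under inverses is immediate.\<close>
  define K where "K = {g \<in> carrier G. \<forall>h \<in> M. g \<otimes> h \<otimes> inv g \<in> M \<and> inv g \<otimes> h \<otimes> g \<in> M}"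
  have "subgroup K G"
  proof (rule subgroupI)
    show "K \<subseteq> carrier G" "K \<noteq> {}" "\<And>a. a \<in> K \<Longrightarrow> inv a \<in> K" by (auto simp: K_def)
  next
    fix a b assume ab: "a \<in> K" "b \<in> K"
    then have c: "a \<in> carrier G" "b \<in> carrier G" by (auto simp: K_def)
    have "(a \<otimes> b) \<otimes> h \<otimes> inv (a \<otimes> b) = a \<otimes> (b \<otimes> h \<otimes> inv b) \<otimes> inv a"
      "inv (a \<otimes> b) \<otimes> h \<otimes> (a \<otimes> b) = inv b \<otimes> (inv a \<otimes> h \<otimes> a) \<otimes> b" if "h \<in> M" for h
      using c that by (simp_all add: m_assoc inv_mult_group)
    then show "a \<otimes> b \<in> K" using ab by (auto simp: K_def)
  qed
  moreover have "M \<subseteq> K" by (auto simp: K_def)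
  moreover have "g \<in> K"
  proof -
    have conj: "g \<otimes> h \<otimes> inv g \<in> M" if h: "h \<in> M" for h
    proof -
      have "R #> h = R" using fixed[of "inv h"] h R(1) by simp
      then have "M #> (g \<otimes> h) = M #> g" using g h M.subset by (simp add: coset_mult_assoc)
      then have "g \<otimes> h \<in> M #> g"
        using g h rcos_self[OF _ M(1), of "g \<otimes> h"] by auto
      then obtain k where "k \<in> M" "g \<otimes> h = k \<otimes> g" by (auto simp: r_coset_def)
      then show ?thesis using g h by (simp add: m_assoc)
    qed
    \<comment> \<open>Conjugation by g maps the finite set \<open>M\<close> injectively into itself,
      hence onto itself, which gives the opposite direction.\<close>
    moreover have "inv g \<otimes> h \<otimes> g \<in> M" if h: "h \<in> M" for h
    proof -
      have "inj_on (\<lambda>h. g \<otimes> h \<otimes> inv g) M"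
        using g(1) M.subset by (auto simp: inj_on_def)
      moreover have "(\<lambda>h. g \<otimes> h \<otimes> inv g) ` M \<subseteq> M" using conj by blast
      moreover have "finite M" using fin M.subset by (rule rev_finite_subset)
      ultimately have "(\<lambda>h. g \<otimes> h \<otimes> inv g) ` M = M" by (simp add: endo_inj_surj)
      then obtain k where k: "k \<in> M" "h = g \<otimes> k \<otimes> inv g" using h by blast
      then have "inv g \<otimes> h \<otimes> g = k" using g(1) by (simp add: word_simps)
      then show ?thesis using k by simp
    qed
    ultimately show ?thesis using g by (auto simp: K_def)
  qed
  moreover have "g \<notin> M" using g R(2) coset_join2[OF g(1) M(1)] by blast
  ultimately have "K = carrier G" using max by blast
  then show ?thesis using M(1) by (auto simp: normal_inv_iff K_def)
qed

lemma p_group_proper_normal: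
  fixes G (structure)
  assumes pG: "p_group G p" and p: "Factorial_Ring.prime p" and H: "subgroup H G" "H \<noteq> carrier G"
  obtains M where "M \<lhd> G" "H \<subseteq> M" "M \<noteq> carrier G"
proof -
  have fin: "finite (carrier G)" using pG by (simp add: p_group_def)
  let ?S = "{K. subgroup K G \<and> H \<subseteq> K \<and> K \<noteq> carrier G}"
  have "?S \<subseteq> Pow (carrier G)" using subgroup.subset by blast
  then have "finite ?S" using fin by (simp add: finite_subset)
  moreover have "?S \<noteq> {}" using H by blast
  ultimately obtain M where M: "M \<in> ?S" "\<forall>K \<in> ?S. M \<subseteq> K \<longrightarrow> M = K"
    using finite_has_maximal[of ?S] by auto
  have "M \<lhd> G" by (rule p_group_maximal_normal[OF pG p]) (use M in auto)
  then show ?thesis using that M by auto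
qed

section \<open>Centres modulo a normal subgroup and two-generated groups of exponent 3\<close>

text \<open>For normal \<open>N\<close> this is the preimage in \<open>G\<close> of the centre of
  G/N. Iterating it yields the upper central series over \<open>N\<close> while staying inside
  \<open>G\<close>, so no nested quotients occur.\<close>

definition center_mod :: "('a, 'b) monoid_scheme \<Rightarrow> 'a set \<Rightarrow> 'a set" where
  "center_mod G N = {x \<in> carrier G. \<forall>g \<in> carrier G. commutator G x g \<in> N}"

lemma (in group_hom) hom_commutator:
  assumes "x \<in> carrier G" "y \<in> carrier G"
  shows "h (commutator G x y) = commutator H (h x) (h y)"
  using assms by (simp add: commutator_def)

context group
begin

lemma commutator_mem_normal:
  assumes "N \<lhd> G" "n \<in> N" "g \<in> carrier G"
  shows "commutator G n g \<in> N"
proof -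
  interpret N: normal N G by fact
  have "commutator G n g = inv n \<otimes> (inv g \<otimes> n \<otimes> g)"
    using assms by (simp add: commutator_def word_simps)
  then show ?thesis using assms by (simp add: N.inv_op_closed1)
qed

text \<open>This is the preimage of the centralizer of the coset of x in G/N. Being a subgroup, it
  carries a commutator condition from generators to the group they generate.\<close>

lemma centralizer_mod_subgroup:
  assumes "N \<lhd> G" "x \<in> carrier G"
  shows "subgroup {g \<in> carrier G. commutator G x g \<in> N} G"
proof -
  interpret N: normal N G by fact
  have x [simp]: "x \<in> carrier G" by fact
  have "commutator G x (inv g) = g \<otimes> inv (commutator G x g) \<otimes> inv g" if "g \<in> carrier G" for g
    using that by (simp add: commutator_def word_simps)
  moreover have "commutator G x \<one> = \<one>" by (simp add: commutator_def)
  ultimately show ?thesis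
    by (intro subgroupI)
      (auto simp: commutator_mult_right commutator_mem_normal[OF assms(1)] N.inv_op_closed2)
qed

lemma center_mod_normal:
  assumes "N \<lhd> G"
  shows "center_mod G N \<lhd> G"
proof -
  interpret N: normal N G by fact
  have inverse: "commutator G (inv x) g = x \<otimes> inv (commutator G x g) \<otimes> inv x"
    if "x \<in> carrier G" "g \<in> carrier G" for x g
    using that by (simp add: commutator_def word_simps)
  have mult: "commutator G (x \<otimes> y) g = inv y \<otimes> commutator G x g \<otimes> y \<otimes> commutator G y g"
    if "x \<in> carrier G" "y \<in> carrier G" "g \<in> carrier G" for x y g
    using that by (simp add: commutator_def word_simps)
  have conj: "commutator G (h \<otimes> x \<otimes> inv h) g = h \<otimes> commutator G x (inv h \<otimes> g \<otimes> h) \<otimes> inv h"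
    if "x \<in> carrier G" "h \<in> carrier G" "g \<in> carrier G" for x h g
    using that by (simp add: commutator_def word_simps)
  have "\<one> \<in> center_mod G N" by (simp add: center_mod_def commutator_def)
  then have "subgroup (center_mod G N) G"
    by (intro subgroupI) (auto simp: center_mod_def mult inverse N.inv_op_closed1 N.inv_op_closed2)
  then show ?thesis
    by (rule normal_invI) (auto simp: center_mod_def conj N.inv_op_closed2)
qed

text \<open>The images of a and b generate G/N and commute, so G/N is abelian. The centralizer
  argument is used twice: first for the generators, then for an arbitrary x.\<close>

lemma commutators_mem_normal:
  assumes N: "N \<lhd> G" and ab: "a \<in> carrier G" "b \<in> carrier G" and gen: "generate G {a, b} = carrier G"
    and "commutator G a b \<in> N" and x: "x \<in> carrier G" and y: "y \<in> carrier G"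
  shows "commutator G x y \<in> N"
proof -
  interpret N: normal N G by fact
  have all: "commutator G u g \<in> N"
    if "u \<in> carrier G" "g \<in> carrier G" "commutator G u a \<in> N" "commutator G u b \<in> N" for u g
  proof -
    have "generate G {a, b} \<subseteq> {g \<in> carrier G. commutator G u g \<in> N}"
      by (rule generate_subgroup_incl[OF _ centralizer_mod_subgroup[OF N]]) (use that ab in auto)
    then show ?thesis using gen that by blast
  qed
  have swap: "commutator G v u \<in> N" if "commutator G u v \<in> N" "u \<in> carrier G" "v \<in> carrier G" for u v
    using that N.m_inv_closed[of "commutator G u v"] by (simp add: inv_commutator)
  have self: "commutator G u u \<in> N" if "u \<in> carrier G" for u
    using that by (simp add: commutator_def word_simps)
  have "commutator G a g \<in> N" "commutator G b g \<in> N" if "g \<in> carrier G" for g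
    using all[of a g] all[of b g] self swap assms that by auto
  then have "commutator G x a \<in> N" "commutator G x b \<in> N"
    using swap ab x by auto
  then show ?thesis using all x y by blast
qed

text \<open>In G/Z all cubes are trivial, so \<open>commutator_commutator_one\<close> applies to
  every pair and G/Z is 2-Engel. Hence [a,b] commutes with both generators modulo \<open>Z\<close>,
  so it is central there, and dividing by that centre leaves an abelian group.\<close>

lemma exponent_3_two_generated:
  assumes Z: "Z \<lhd> G" and cubes: "\<And>x. x \<in> carrier G \<Longrightarrow> x [^] (3::nat) \<in> Z"
    and ab: "a \<in> carrier G" "b \<in> carrier G" and gen: "generate G {a, b} = carrier G"
  shows "carrier G \<subseteq> center_mod G (center_mod G Z)"
proof -
  interpret Z: normal Z G by fact
  interpret Q: group "G Mod Z" by (rule Z.factorgroup_is_group)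
  interpret \<pi>: group_hom G "G Mod Z" "\<lambda>g. Z #> g"
    by unfold_locales (rule Z.r_coset_hom_Mod)
  have Q3: "U [^]\<^bsub>G Mod Z\<^esub> (3::nat) = \<one>\<^bsub>G Mod Z\<^esub>" if U: "U \<in> carrier (G Mod Z)" for U
  proof -
    obtain x where x: "x \<in> carrier G" "U = Z #> x" using U by (auto simp: FactGroup_def RCOSETS_def)
    then have "U [^]\<^bsub>G Mod Z\<^esub> (3::nat) = Z #> (x [^] (3::nat))" by (simp add: \<pi>.hom_nat_pow)
    also have "\<dots> = \<one>\<^bsub>G Mod Z\<^esub>" using cubes x(1) by (simp add: Z.rcos_const one_FactGroup)
    finally show ?thesis .
  qed
  have engel: "commutator G (commutator G u v) v \<in> Z" if uv: "u \<in> carrier G" "v \<in> carrier G" for u v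
  proof -
    have carr: "Z #> u \<in> carrier (G Mod Z)" "Z #> v \<in> carrier (G Mod Z)"
      using uv by (auto simp only: \<pi>.hom_closed)
    have "Z #> commutator G (commutator G u v) v
        = commutator (G Mod Z) (commutator (G Mod Z) (Z #> u) (Z #> v)) (Z #> v)"
      using uv by (simp only: \<pi>.hom_commutator commutator_closed)
    also have "\<dots> = \<one>\<^bsub>G Mod Z\<^esub>"
      by (rule Q.commutator_commutator_one) (use carr in \<open>simp_all only: Q3 Q.m_closed Q.inv_closed\<close>)
    finally show ?thesis
      using uv rcos_self[OF _ Z.subgroup_axioms, of "commutator G (commutator G u v) v"] by simp
  qed
  let ?u = "commutator G a b"
  have "commutator G ?u b \<in> Z" using engel ab by simp
  \<comment> \<open>The Engel law speaks of [a,b,b] and [b,a,a]; the remaining [a,b,a] is conjugate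
    to the inverse of [b,a,a].\<close>
  moreover have "commutator G ?u a \<in> Z"
  proof -
    have "commutator G ?u a = inv ?u \<otimes> inv (commutator G (inv ?u) a) \<otimes> ?u"
      using ab by (simp add: commutator_def word_simps)
    moreover have "commutator G (inv ?u) a \<in> Z" using engel ab by (simp add: inv_commutator)
    ultimately show ?thesis using ab by (simp add: Z.inv_op_closed1)
  qed
  ultimately have "generate G {a, b} \<subseteq> {g \<in> carrier G. commutator G ?u g \<in> Z}"
    using ab by (intro generate_subgroup_incl[OF _ centralizer_mod_subgroup[OF Z]]) auto
  then have "?u \<in> center_mod G Z" using ab gen by (auto simp: center_mod_def)
  then show ?thesis
    using commutators_mem_normal[OF center_mod_normal[OF Z] ab gen] by (auto simp: center_mod_def[of G "center_mod G Z"])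
qed

lemma generate_commute:
  assumes S: "S \<subseteq> carrier G" and comm: "\<And>x y. x \<in> S \<Longrightarrow> y \<in> S \<Longrightarrow> x \<otimes> y = y \<otimes> x"
    and "x \<in> generate G S" "y \<in> generate G S"
  shows "x \<otimes> y = y \<otimes> x"
proof -
  have step: "u \<otimes> v = v \<otimes> u"
    if u: "u \<in> carrier G" and S: "S \<subseteq> carrier G" and us: "\<And>s. s \<in> S \<Longrightarrow> u \<otimes> s = s \<otimes> u"
      and v: "v \<in> generate G S" for u v
  proof -
    have "generate G S \<subseteq> {g \<in> carrier G. commutator G u g \<in> {\<one>}}"
      by (rule generate_subgroup_incl[OF _ centralizer_mod_subgroup[OF one_is_normal u]])
        (use u S us in \<open>auto simp: commutator_eq_one_iff\<close>)
    then show ?thesis using u v by (auto simp: commutator_eq_one_iff)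
  qed
  have "u \<otimes> v = v \<otimes> u" if "u \<in> S" "v \<in> generate G S" for u v
    using step[OF _ S comm] that S by blast
  then show ?thesis
    using step[OF _ S, of x y] assms generate_in_carrier[OF S] by (metis (no_types, lifting))
qed

text \<open>One step down the lower central series removes one layer of \<open>center_mod\<close>;
  this drives the final descent.\<close>

lemma lcs_Suc_subset:
  assumes "lcs G n \<subseteq> center_mod G N" "N \<lhd> G"
  shows "lcs G (Suc n) \<subseteq> N"
  unfolding lcs.simps commutator_subgroup_def
  by (rule generate_subgroup_incl) (use assms normal_imp_subgroup in \<open>auto simp: center_mod_def\<close>)

section \<open>Powers, roots and commutators in semi-abelian subgroups\<close>

lemma semi_abelian_eq_iff:
  assumes M: "subgroup M G" and "semi_abelian (G\<lparr>carrier := M\<rparr>) p i" "x \<in> M" "y \<in> M"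
  shows "(x \<otimes> inv y) [^] (p ^ i) = \<one> \<longleftrightarrow> x [^] (p ^ i) = y [^] (p ^ i)"
proof -
  interpret M: subgroup M G by (fact M)
  have iy: "inv y \<in> M" using assms by blast
  have a: "(x \<otimes> inv y) [^] (p ^ i) = \<one> \<longleftrightarrow> x [^] (p ^ i) \<otimes> inv y [^] (p ^ i) = \<one>"
    using assms(2) assms(3) iy unfolding semi_abelian_def nat_pow_consistent[symmetric] by auto
  have b: "inv y [^] (p ^ i) = inv (y [^] (p ^ i))" using assms(4) by (simp add: nat_pow_inv)
  have c: "x [^] (p ^ i) \<in> carrier G" "y [^] (p ^ i) \<in> carrier G" using assms by auto
  show ?thesis unfolding a b using c by (metis inv_equality inv_inv inv_closed r_inv)
qed

lemma pow_conjugate: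
  assumes "x \<in> carrier G" "g \<in> carrier G"
  shows "(inv g \<otimes> x \<otimes> g) [^] (n::nat) = inv g \<otimes> x [^] n \<otimes> g"
  using assms by (induction n) (simp_all add: word_simps)

lemma semi_abelian_roots_normal:
  assumes M: "M \<lhd> G" and semi: "semi_abelian (G\<lparr>carrier := M\<rparr>) p i"
  shows "{x \<in> M. x [^] (p ^ i) = \<one>} \<lhd> G" (is "?R \<lhd> G")
proof -
  interpret M: normal M G by fact
  note iff = semi_abelian_eq_iff[OF M.subgroup_axioms semi]
  have inverse: "inv x \<in> ?R" if "x \<in> ?R" for x using that by (simp add: nat_pow_inv)
  have "x \<otimes> y \<in> ?R" if "x \<in> ?R" "y \<in> ?R" for x y
    using that inverse[of y] iff[of x "inv y"] by simp
  then have "subgroup ?R G"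
    using M.subset inverse by (intro subgroup.intro) auto
  moreover have "x \<otimes> h \<otimes> inv x \<in> ?R" if "x \<in> carrier G" "h \<in> ?R" for x h
    using that pow_conjugate[of h "inv x"] by (simp add: M.inv_op_closed2)
  ultimately show ?thesis by (rule normal_invI)
qed

text \<open>[x,g] is the quotient of two elements of \<open>M\<close>, the inverse of x and the
  inverse of its conjugate by g, so \<open>semi_abelian_eq_iff\<close> applies to them although g
  itself may lie outside \<open>M\<close>.\<close>

lemma semi_abelian_commutator_pow:
  assumes M: "M \<lhd> G" and semi: "semi_abelian (G\<lparr>carrier := M\<rparr>) p i"
    and x: "x \<in> M" and g: "g \<in> carrier G"
  shows "commutator G x g [^] (p ^ i) = \<one> \<longleftrightarrow> x [^] (p ^ i) \<otimes> g = g \<otimes> x [^] (p ^ i)"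
proof -
  interpret M: normal M G by fact
  define u where "u = inv g \<otimes> x \<otimes> g"
  have u: "u \<in> M" using x g by (simp add: u_def M.inv_op_closed1)
  have "commutator G x g = inv x \<otimes> inv (inv u)" using x g by (simp add: u_def commutator_def word_simps)
  then have "commutator G x g [^] (p ^ i) = \<one> \<longleftrightarrow> inv x [^] (p ^ i) = inv u [^] (p ^ i)"
    using semi_abelian_eq_iff[OF M.subgroup_axioms semi, of "inv x" "inv u"] x u by simp
  also have "\<dots> \<longleftrightarrow> x [^] (p ^ i) = u [^] (p ^ i)"
    using x u by (metis M.mem_carrier inv_inv nat_pow_closed nat_pow_inv)
  also have "u [^] (p ^ i) = inv g \<otimes> x [^] (p ^ i) \<otimes> g"
    using x g by (simp add: u_def pow_conjugate)
  also have "\<dots> = inv g \<otimes> (x [^] (p ^ i) \<otimes> g)"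
    using x g by (simp add: m_assoc)
  also have "x [^] (p ^ i) = \<dots> \<longleftrightarrow> x [^] (p ^ i) \<otimes> g = g \<otimes> x [^] (p ^ i)"
    by (rule inv_solve_left) (use x g in auto)
  finally show ?thesis .
qed

lemma semi_3_abelian_cube_roots:
  assumes semi: "semi_abelian G 3 1"
  shows "{x \<in> carrier G. x [^] (3::nat) = \<one>}
    \<subseteq> center_mod G (center_mod G (center_mod G {\<one>}))"
proof
  define R where "R = {x \<in> carrier G. x [^] (3::nat) = \<one>}"
  fix x assume "x \<in> {x \<in> carrier G. x [^] (3::nat) = \<one>}"
  then have x: "x \<in> R" by (simp add: R_def)
  then have [simp]: "x \<in> carrier G" by (simp add: R_def)
  have semi': "semi_abelian (G\<lparr>carrier := carrier G\<rparr>) 3 1" using semi by simp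
  have R: "R \<lhd> G"
    using semi_abelian_roots_normal[OF normal_self semi'] unfolding R_def power_one_right .
  have R3: "r [^] (3::nat) = \<one>" if "r \<in> R" for r using that by (simp add: R_def)
  interpret R: normal R G by (fact R)
  \<comment> \<open>The conjugate of r by g is the quotient of gr by g, and its cube is trivial; the
    semi-3-abelian condition turns this into equality of cubes.\<close>
  have cube: "(g \<otimes> r) [^] (3::nat) = g [^] (3::nat)" if "r \<in> R" "g \<in> carrier G" for r g
  proof -
    have "g \<otimes> r \<otimes> inv g \<in> R" using that by (simp add: R.inv_op_closed2)
    then have "(g \<otimes> r \<otimes> inv g) [^] (3::nat) = \<one>" by (rule R3)
    moreover have "g \<otimes> r \<in> carrier G" using that by simp
    ultimately show ?thesis
      using semi_abelian_eq_iff[OF subgroup_self semi', of "g \<otimes> r" g] that(2)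
      unfolding power_one_right by simp
  qed
  define S where "S = {g \<otimes> x \<otimes> inv g | g. g \<in> carrier G}"
  have S: "S \<subseteq> R" using x by (auto simp: S_def R.inv_op_closed2)
  then have S': "S \<subseteq> carrier G" using R.subset by blast
  have V: "generate G S \<lhd> G"
  proof (rule normal_generateI[OF S'])
    fix s g assume "s \<in> S" and g: "g \<in> carrier G"
    then obtain h where h: "h \<in> carrier G" "s = h \<otimes> x \<otimes> inv h" by (auto simp: S_def)
    then have "g \<otimes> s \<otimes> inv g = (g \<otimes> h) \<otimes> x \<otimes> inv (g \<otimes> h)" using g by (simp add: word_simps)
    then show "g \<otimes> s \<otimes> inv g \<in> S" using g h unfolding S_def by blast
  qed
  have V_R: "generate G S \<subseteq> R" by (rule generate_subgroup_incl[OF S R.subgroup_axioms])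
  have comm_S: "s \<otimes> t = t \<otimes> s" if st: "s \<in> S" "t \<in> S" for s t
  proof -
    obtain g h where g: "g \<in> carrier G" "s = g \<otimes> x \<otimes> inv g" and h: "h \<in> carrier G" "t = h \<otimes> x \<otimes> inv h"
      using st by (auto simp: S_def)
    \<comment> \<open>Any two conjugates of x are conjugate to each other, which is the situation of
      \<open>commute_conjugate\<close>.\<close>
    have t: "t = inv (g \<otimes> inv h) \<otimes> s \<otimes> (g \<otimes> inv h)" using g h by (simp add: word_simps)
    have s: "s \<in> R" using S st by blast
    show ?thesis unfolding t
      by (rule commute_conjugate) (use s g h in \<open>simp_all add: cube\<close>)
  qed
  have V3: "v [^] (3::nat) = \<one>" if "v \<in> generate G S" for v using that V_R R3 by blast
  have comm: "v \<otimes> w = w \<otimes> v" if "v \<in> generate G S" "w \<in> generate G S" for v w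
    by (rule generate_commute[OF S' comm_S that])
  have engel: "commutator G (commutator G v g) g = \<one>" if "v \<in> generate G S" "g \<in> carrier G" for v g
  proof -
    have v: "v \<in> R" using that V_R by blast
    then have "inv v \<in> R" by (rule R.m_inv_closed)
    then show ?thesis using v that by (intro commutator_commutator_one) (simp_all add: cube R3)
  qed
  have "x = \<one> \<otimes> x \<otimes> inv \<one>" by simp
  then have "x \<in> S" unfolding S_def by blast
  then have "x \<in> generate G S" by (rule generate.incl)
  then show "x \<in> center_mod G (center_mod G (center_mod G {\<one>}))"
    using triple_commutator_one[OF V comm V3 engel] by (auto simp: center_mod_def)
qed

end

text \<open>Apply \<open>semi_abelian_commutator_pow\<close> with \<open>M\<close> the whole group
  to x^3: the cube of [x^3,g] is trivial exactly when x^9 commutes with g.\<close>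

lemma semi_3_abelian_cube_mem_center_mod:
  fixes G (structure)
  assumes "group G" and semi: "semi_abelian G 3 1"
    and cubes: "\<And>x y. x \<in> carrier G \<Longrightarrow> y \<in> carrier G \<Longrightarrow> x [^] (9::nat) \<otimes> y = y \<otimes> x [^] (9::nat)"
    and x: "x \<in> carrier G"
  shows "x [^] (3::nat) \<in> center_mod G {x \<in> carrier G. x [^] (3::nat) = \<one>}"
proof -
  interpret group G by fact
  have semi': "semi_abelian (G\<lparr>carrier := carrier G\<rparr>) 3 1" using semi by simp
  have "commutator G (x [^] (3::nat)) g [^] (3::nat) = \<one>" if g: "g \<in> carrier G" for g
  proof -
    have "(x [^] (3::nat)) [^] (3::nat) = x [^] (9::nat)" using x by (simp add: nat_pow_pow)
    then show ?thesis
      using semi_abelian_commutator_pow[OF normal_self semi', of "x [^] (3::nat)" g] cubes[OF x g] x g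
      unfolding power_one_right by simp
  qed
  then show ?thesis using x by (simp add: center_mod_def)
qed

theorem theorem1p2:
  fixes G :: "('a, 'b) monoid_scheme"
  assumes "p_group G 3"
    and "semi_abelian G 3 1"
    and "\<not> semi_abelian G 3 2"
    and "\<And>H. subgroup H G \<Longrightarrow> H \<noteq> carrier G \<Longrightarrow> semi_abelian (G\<lparr>carrier := H\<rparr>) 3 2"
  shows "lower_central_term G 7 = {\<one>\<^bsub>G\<^esub>}"
proof -
  interpret group G using assms(1) by (simp add: p_group_def)
  note proper = assms(4)
  have prime_3: "Factorial_Ring.prime (3::nat)" by simp
  have nine: "(3::nat) ^ 2 = 9" by simp
  obtain a b where ab: "a \<in> carrier G" "b \<in> carrier G"
      and fails: "((a \<otimes>\<^bsub>G\<^esub> b) [^]\<^bsub>G\<^esub> (9::nat) = \<one>\<^bsub>G\<^esub>) \<noteq>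
        (a [^]\<^bsub>G\<^esub> (9::nat) \<otimes>\<^bsub>G\<^esub> b [^]\<^bsub>G\<^esub> (9::nat) = \<one>\<^bsub>G\<^esub>)"
    using assms(3) unfolding semi_abelian_def nine by auto
  have gen: "generate G {a, b} = carrier G"
  proof (rule ccontr)
    assume neq: "generate G {a, b} \<noteq> carrier G"
    have "subgroup (generate G {a, b}) G" using ab by (intro generate_is_subgroup) auto
    then have "semi_abelian (G\<lparr>carrier := generate G {a, b}\<rparr>) 3 2" using neq by (rule proper)
    moreover have "a \<in> generate G {a, b}" "b \<in> generate G {a, b}" by (auto intro: generate.incl)
    ultimately show False
      using fails unfolding semi_abelian_def nat_pow_consistent[symmetric] nine by auto
  qed
  \<comment> \<open>In a cyclic group a and b would commute and (ab)^9 = a^9 b^9. So each single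
    element generates a proper subgroup, which can be enlarged to a proper normal one.\<close>
  have cyclic: "generate G {x} \<noteq> carrier G" if x: "x \<in> carrier G" for x
  proof
    assume "generate G {x} = carrier G"
    then have "a \<otimes>\<^bsub>G\<^esub> b = b \<otimes>\<^bsub>G\<^esub> a"
      using generate_commute[of "{x}" a b] x ab by simp
    then show False using fails pow_mult_distrib[OF _ ab] by simp
  qed
  have ex_M: "\<exists>M. M \<lhd> G \<and> x \<in> M \<and> semi_abelian (G\<lparr>carrier := M\<rparr>) 3 2"
    if x: "x \<in> carrier G" for x
  proof -
    have sub: "subgroup (generate G {x}) G" using x by (intro generate_is_subgroup) auto
    obtain M where "M \<lhd> G" "generate G {x} \<subseteq> M" "M \<noteq> carrier G"
      by (rule p_group_proper_normal[OF assms(1) prime_3 sub cyclic[OF x]])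
    then show ?thesis using proper[OF normal_imp_subgroup] generate.incl[of x "{x}" G] by blast
  qed
  have comm_iff: "commutator G x y [^]\<^bsub>G\<^esub> (9::nat) = \<one>\<^bsub>G\<^esub> \<longleftrightarrow>
      x [^]\<^bsub>G\<^esub> (9::nat) \<otimes>\<^bsub>G\<^esub> y = y \<otimes>\<^bsub>G\<^esub> x [^]\<^bsub>G\<^esub> (9::nat)"
    if xy: "x \<in> carrier G" "y \<in> carrier G" for x y
  proof -
    obtain M where M: "M \<lhd> G" "x \<in> M" "semi_abelian (G\<lparr>carrier := M\<rparr>) 3 2"
      using ex_M[OF xy(1)] by blast
    show ?thesis using semi_abelian_commutator_pow[OF M(1,3,2) xy(2)] unfolding nine .
  qed
  have ex_N: "\<exists>N. N \<lhd> G \<and> x \<in> N \<and> (\<forall>n \<in> N. n [^]\<^bsub>G\<^esub> (9::nat) = \<one>\<^bsub>G\<^esub>)"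
    if x: "x \<in> carrier G" "x [^]\<^bsub>G\<^esub> (9::nat) = \<one>\<^bsub>G\<^esub>" for x
  proof -
    obtain M where M: "M \<lhd> G" "x \<in> M" "semi_abelian (G\<lparr>carrier := M\<rparr>) 3 2"
      using ex_M[OF x(1)] by blast
    then show ?thesis using semi_abelian_roots_normal[OF M(1,3)] x(2) unfolding nine by blast
  qed
  obtain N where N: "N \<lhd> G" "commutator G a b \<in> N"
      and N9: "\<And>n. n \<in> N \<Longrightarrow> n [^]\<^bsub>G\<^esub> (9::nat) = \<one>\<^bsub>G\<^esub>"
  proof (cases "(a \<otimes>\<^bsub>G\<^esub> b) [^]\<^bsub>G\<^esub> (9::nat) = \<one>\<^bsub>G\<^esub>")
    case True
    obtain N where N: "N \<lhd> G" "a \<otimes>\<^bsub>G\<^esub> b \<in> N" "\<forall>n \<in> N. n [^]\<^bsub>G\<^esub> (9::nat) = \<one>\<^bsub>G\<^esub>"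
      using ex_N[OF _ True] ab by auto
    interpret N: normal N G by (fact N(1))
    \<comment> \<open>Here [a,b] is the inverse of ba times ab, and ba is the conjugate of ab by the
      inverse of b.\<close>
    have "commutator G a b = inv\<^bsub>G\<^esub> (b \<otimes>\<^bsub>G\<^esub> (a \<otimes>\<^bsub>G\<^esub> b) \<otimes>\<^bsub>G\<^esub> inv\<^bsub>G\<^esub> b) \<otimes>\<^bsub>G\<^esub> (a \<otimes>\<^bsub>G\<^esub> b)"
      using ab by (simp add: commutator_def word_simps)
    also have "\<dots> \<in> N"
      by (rule N.m_closed[OF N.m_inv_closed[OF N.inv_op_closed2[OF ab(2) N(2)]] N(2)])
    finally show ?thesis using that N by blast
  next
    case False
    then have "a [^]\<^bsub>G\<^esub> (9::nat) \<otimes>\<^bsub>G\<^esub> b [^]\<^bsub>G\<^esub> (9::nat) = \<one>\<^bsub>G\<^esub>" using fails by blast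
    then have "a [^]\<^bsub>G\<^esub> (9::nat) = inv\<^bsub>G\<^esub> b [^]\<^bsub>G\<^esub> (9::nat)"
      using ab by (metis inv_equality nat_pow_closed nat_pow_inv)
    moreover have "inv\<^bsub>G\<^esub> b [^]\<^bsub>G\<^esub> (9::nat) \<otimes>\<^bsub>G\<^esub> b = b \<otimes>\<^bsub>G\<^esub> inv\<^bsub>G\<^esub> b [^]\<^bsub>G\<^esub> (9::nat)"
      using ab by (intro group_commutes_pow) auto
    ultimately have "commutator G a b [^]\<^bsub>G\<^esub> (9::nat) = \<one>\<^bsub>G\<^esub>" using comm_iff[OF ab] by simp
    then show ?thesis using ex_N[of "commutator G a b"] that ab by auto
  qed
  have "x [^]\<^bsub>G\<^esub> (9::nat) \<otimes>\<^bsub>G\<^esub> y = y \<otimes>\<^bsub>G\<^esub> x [^]\<^bsub>G\<^esub> (9::nat)"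
    if "x \<in> carrier G" "y \<in> carrier G" for x y
    using comm_iff[OF that] N9[OF commutators_mem_normal[OF N(1) ab gen N(2) that]] by blast
  note cube = semi_3_abelian_cube_mem_center_mod[OF is_group assms(2) this]
  let ?R = "{x \<in> carrier G. x [^]\<^bsub>G\<^esub> (3::nat) = \<one>\<^bsub>G\<^esub>}"
  let ?C = "center_mod G"
  have "semi_abelian (G\<lparr>carrier := carrier G\<rparr>) 3 1" using assms(2) by simp
  from semi_abelian_roots_normal[OF normal_self this] have R: "?R \<lhd> G"
    unfolding power_one_right .
  \<comment> \<open>Modulo \<open>?C ?R\<close> the group has exponent 3, so three layers of
    \<open>?C\<close> over \<open>?R\<close> exhaust \<open>G\<close>. Three descents reach
    \<open>?R\<close>, which lies in the third centre of \<open>G\<close>, and three more reach 1.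
    As \<open>lcs G n\<close> is the term with index n + 1, the six descents end at the seventh
    term.\<close>
  have "lcs G 0 \<subseteq> ?C (?C (?C ?R))"
    using exponent_3_two_generated[OF center_mod_normal[OF R] cube ab gen] by simp
  then have "lcs G (Suc 0) \<subseteq> ?C (?C ?R)"
    by (rule lcs_Suc_subset) (intro center_mod_normal R)
  then have "lcs G (Suc (Suc 0)) \<subseteq> ?C ?R"
    by (rule lcs_Suc_subset) (intro center_mod_normal R)
  then have "lcs G (Suc (Suc (Suc 0))) \<subseteq> ?R"
    by (rule lcs_Suc_subset) (rule R)
  also have "?R \<subseteq> ?C (?C (?C {\<one>\<^bsub>G\<^esub>}))" by (rule semi_3_abelian_cube_roots[OF assms(2)])
  finally have "lcs G (Suc (Suc (Suc (Suc 0)))) \<subseteq> ?C (?C {\<one>\<^bsub>G\<^esub>})"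
    by (rule lcs_Suc_subset) (intro center_mod_normal one_is_normal)
  then have "lcs G (Suc (Suc (Suc (Suc (Suc 0))))) \<subseteq> ?C {\<one>\<^bsub>G\<^esub>}"
    by (rule lcs_Suc_subset) (intro center_mod_normal one_is_normal)
  then have "lcs G (Suc (Suc (Suc (Suc (Suc (Suc 0)))))) \<subseteq> {\<one>\<^bsub>G\<^esub>}"
    by (rule lcs_Suc_subset) (rule one_is_normal)
  moreover have "lower_central_term G 7 = lcs G (Suc (Suc (Suc (Suc (Suc (Suc 0))))))"
    by (simp add: lower_central_term_def numeral_eq_Suc del: lcs.simps)
  moreover have "\<one>\<^bsub>G\<^esub> \<in> lcs G (Suc n)" for n
    by (simp add: commutator_subgroup_def generate.one)
  ultimately show ?thesis by blast
qed

end
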